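(* For every integer $n\ge 2$, $$J(n,\ast,n-2)=\sum_{k=0}^n(-1)^k\binom{n}{k}(n-k)!.$$
   Context: A site swap juggling pattern of period $n$ with $b$ balls is an $n$-tuple $(h_0,h_1,\ldots,h_{n-1})$ of non-negative integers such that (1) $i+h_i\not\equiv j+h_j \pmod n$ for all $0\le i<j\le n-1$, and (2) $\sum_{i=0}^{n-1}h_i=bn$. Patterns are counted as ordered $n$-tuples (cyclic shifts are not identified). For an integer $c\ge 0$, $J(n,b,c)$ denotes the number of such patterns with $h_i\le c$ for every $i$, and $J(n,\ast,c)=\sum_{b=0}^{c}J(n,b,c)$ is the number of such patterns with any number of balls. *)

theory Defs
  imports "HOL-Number_Theory.Cong"
begin

definition siteswap :: "nat \<Rightarrow> nat \<Rightarrow> nat list \<Rightarrow> bool" where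
  "siteswap n b h \<longleftrightarrow>
     length h = n \<and>
     (\<forall>i j. i < j \<and> j < n \<longrightarrow> \<not> [i + h ! i = j + h ! j] (mod n)) \<and>
     (\<Sum>i<n. h ! i) = b * n"

definition J :: "nat \<Rightarrow> nat \<Rightarrow> nat \<Rightarrow> nat" where
  "J n b c = card {h. siteswap n b h \<and> (\<forall>i<n. h ! i \<le> c)}"

definition J_all :: "nat \<Rightarrow> nat \<Rightarrow> nat" where
  "J_all n c = (\<Sum>b=0..c. J n b c)"

end

theory Submission
  imports Defs "HOL-Combinatorics.Permutations"
begin

text \<open>
  The right-hand side is the number of derangements of \<open>n\<close> points, and the patterns counted on the
  left correspond to these derangements.

  A siteswap \<open>h\<close> sends a ball thrown at time \<open>i\<close> to be caught at time \<open>i + h\<^sub>i\<close>; modulo \<open>n\<close> this is a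
  permutation of \<open>{..<n}\<close>.  When every height is less than \<open>n\<close>, the permutation determines \<open>h\<close>.
  The heights \<open>0, \<dots>, n - 1\<close> represent each residue once, and excluding the single height \<open>n - 1\<close>
  means that \<open>i\<close> is never sent to \<open>i - 1\<close>.  After composition with the shift \<open>x \<mapsto> x + 1\<close> this says
  that no point is fixed (lemma \<open>throw_perm_bij\<close>).  The number of balls imposes no further condition:
  since the landing times are a rearrangement of \<open>0, \<dots>, n - 1\<close> modulo \<open>n\<close>, the sum of the heights is
  divisible by \<open>n\<close>, and the bound \<open>h\<^sub>i \<le> c\<close> keeps the average at most \<open>c\<close>; so summing over
  \<open>b \<le> c\<close> merely removes the condition on that sum (lemma
  \<open>J_all_eq_card\<close>).

  Derangements are counted by Moebius inversion: a permutation of \<open>S\<close> is a derangement of the set of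
  points that it moves, so \<open>|S|! = (\<Sum>T\<subseteq>S. D T)\<close> with \<open>D T\<close> the number of derangements of \<open>T\<close>.
\<close>

section \<open>Counting derangements\<close>

definition derangements :: "'a set \<Rightarrow> ('a \<Rightarrow> 'a) set" where
  "derangements S = {p. p permutes S \<and> (\<forall>x\<in>S. p x \<noteq> x)}"

text \<open>Each permutation of \<open>S\<close> is counted on the right at exactly one \<open>T\<close>, its set of moved points.\<close>

lemma fact_card_eq_sum_derangements:
  assumes "finite S"
  shows "fact (card S) = (\<Sum>T\<in>Pow S. card (derangements T))"
proof -
  have "{p. p permutes S} = (\<Union>T\<in>Pow S. derangements T)"
  proof (intro equalityI subsetI)
    fix p assume "p \<in> {p. p permutes S}"
    then have p: "p permutes S" by simp
    have "p permutes {x. p x \<noteq> x}"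
      by (rule permutes_superset[OF p]) auto
    moreover have "{x. p x \<noteq> x} \<subseteq> S"
      using p by (auto simp: permutes_altdef)
    ultimately show "p \<in> (\<Union>T\<in>Pow S. derangements T)"
      by (auto simp: derangements_def)
  next
    fix p assume "p \<in> (\<Union>T\<in>Pow S. derangements T)"
    then show "p \<in> {p. p permutes S}"
      by (auto simp: derangements_def intro: permutes_subset)
  qed
  moreover have "card (\<Union>T\<in>Pow S. derangements T) = (\<Sum>T\<in>Pow S. card (derangements T))"
  proof (rule card_UN_disjoint)
    show "finite (Pow S)" using assms by simp
    show "\<forall>T\<in>Pow S. finite (derangements T)"
      using assms unfolding derangements_def
      by (auto intro: finite_subset[OF _ finite_permutations[of S]] permutes_subset)
    have moved: "T = {x. p x \<noteq> x}" if "p \<in> derangements T" for T and p :: "'a \<Rightarrow> 'a"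
      using that by (auto simp: derangements_def dest: permutes_not_in)
    show "\<forall>T\<in>Pow S. \<forall>U\<in>Pow S. T \<noteq> U \<longrightarrow> derangements T \<inter> derangements U = {}"
      using moved by blast
  qed
  ultimately show ?thesis
    using card_permutations[OF refl assms] by simp
qed

lemma sum_Pow_card:
  fixes f :: "nat \<Rightarrow> int"
  assumes "finite S"
  shows "(\<Sum>T\<in>Pow S. f (card T)) = (\<Sum>k=0..card S. int (card S choose k) * f k)"
proof -
  have "(\<Sum>T\<in>Pow S. f (card T))
      = (\<Sum>k\<in>{0..card S}. \<Sum>T\<in>{T\<in>Pow S. card T = k}. f (card T))"
    using assms by (intro sum.group[symmetric]) (auto intro: card_mono)
  also have "\<dots> = (\<Sum>k=0..card S. int (card S choose k) * f k)"
    using assms by (intro sum.cong) (auto simp: n_subsets)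
  finally show ?thesis .
qed

lemma card_derangements:
  assumes "finite S"
  shows "int (card (derangements S))
    = (\<Sum>k=0..card S. (-1) ^ k * int (card S choose k) * fact (card S - k))"
proof -
  have "int (card (derangements S))
      = (\<Sum>T\<in>Pow S. (-1) ^ (card S - card T) * fact (card T))"
  proof (rule inclusion_exclusion_mobius[OF _ assms])
    fix T :: "'a set" assume "finite T"
    then show "fact (card T) = (\<Sum>U\<in>Pow T. int (card (derangements U)))"
      using fact_card_eq_sum_derangements[of T] by (metis of_nat_fact of_nat_sum)
  qed
  also have "\<dots> = (\<Sum>k=0..card S. int (card S choose k) * ((-1) ^ (card S - k) * fact k))"
    by (rule sum_Pow_card[OF assms])
  also have "\<dots> = (\<Sum>k=0..card S. (-1) ^ k * int (card S choose k) * fact (card S - k))"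
    by (rule sum.reindex_bij_witness[of _ "\<lambda>k. card S - k" "\<lambda>k. card S - k"])
       (auto simp: binomial_symmetric[symmetric])
  finally show ?thesis .
qed

section \<open>Bounded siteswaps with any number of balls\<close>

definition throws :: "nat \<Rightarrow> nat \<Rightarrow> nat list set" where
  "throws n c = {h. length h = n \<and> inj_on (\<lambda>i. (i + h ! i) mod n) {..<n} \<and> (\<forall>i<n. h ! i \<le> c)}"

lemma inj_on_mod_self_image:
  fixes f :: "nat \<Rightarrow> nat"
  assumes "n > 0" and "inj_on (\<lambda>i. f i mod n) {..<n}"
  shows "(\<lambda>i. f i mod n) ` {..<n} = {..<n}"
  using assms by (intro endo_inj_surj) auto

text \<open>The landing times modulo \<open>n\<close> have the same sum as the throwing times.\<close>

lemma dvd_sum_throws: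
  assumes "n > 0" and "h \<in> throws n c"
  shows "n dvd (\<Sum>i<n. h ! i)"
proof -
  have inj: "inj_on (\<lambda>i. (i + h ! i) mod n) {..<n}"
    using assms(2) by (simp add: throws_def)
  have "(\<Sum>i<n. (i + h ! i) mod n) = \<Sum>{..<n}"
    using sum.reindex[OF inj, of "\<lambda>x. x"] inj_on_mod_self_image[OF assms(1) inj] by simp
  moreover have "[(\<Sum>i<n. (i + h ! i) mod n) = (\<Sum>i<n. i + h ! i)] (mod n)"
    by (rule cong_sum) simp
  ultimately have "[\<Sum>{..<n} + (\<Sum>i<n. h ! i) = \<Sum>{..<n}] (mod n)"
    by (simp add: sum.distrib cong_sym_eq)
  then show ?thesis
    by (simp add: cong_add_lcancel_0_nat cong_0_iff)
qed

lemma siteswap_iff: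
  "siteswap n b h \<and> (\<forall>i<n. h ! i \<le> c) \<longleftrightarrow> h \<in> throws n c \<and> (\<Sum>i<n. h ! i) = b * n"
proof -
  have "(\<forall>i j. i < j \<and> j < n \<longrightarrow> \<not> [i + h ! i = j + h ! j] (mod n))
      \<longleftrightarrow> inj_on (\<lambda>i. (i + h ! i) mod n) {..<n}" (is "?L \<longleftrightarrow> ?R")
  proof
    assume L: ?L
    show ?R
    proof (rule linorder_inj_onI)
      fix i j assume "i < j" "i \<in> {..<n}" "j \<in> {..<n}"
      with L show "(i + h ! i) mod n \<noteq> (j + h ! j) mod n"
        unfolding cong_def by blast
    qed auto
  next
    assume R: ?R
    show ?L
    proof (intro allI impI notI)
      fix i j assume ij: "i < j \<and> j < n" and "[i + h ! i = j + h ! j] (mod n)"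
      then have "(i + h ! i) mod n = (j + h ! j) mod n" by (simp only: cong_def)
      then have "i = j"
        by (rule inj_onD[OF R]) (use ij in auto)
      with ij show False by simp
    qed
  qed
  then show ?thesis by (auto simp: siteswap_def throws_def)
qed

lemma finite_throws: "finite (throws n c)"
proof (rule finite_subset)
  show "throws n c \<subseteq> {h. set h \<subseteq> {..c} \<and> length h = n}"
    by (auto simp: throws_def in_set_conv_nth)
qed (simp add: finite_lists_length_eq)

lemma J_all_eq_card:
  assumes "n > 0"
  shows "J_all n c = card (throws n c)"
proof -
  define A where "A b = {h \<in> throws n c. (\<Sum>i<n. h ! i) = b * n}" for b
  have "throws n c = (\<Union>b\<in>{0..c}. A b)"
  proof (intro equalityI subsetI)
    fix h assume h: "h \<in> throws n c"
    then obtain b where b: "(\<Sum>i<n. h ! i) = b * n"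
      using dvd_sum_throws[OF assms h] by (metis dvd_def mult.commute)
    have "(\<Sum>i<n. h ! i) \<le> (\<Sum>i<n. c)"
      using h by (intro sum_mono) (auto simp: throws_def)
    then have "b \<le> c" using b assms by simp
    then show "h \<in> (\<Union>b\<in>{0..c}. A b)" using h b by (auto simp: A_def)
  qed (auto simp: A_def)
  moreover have "card (\<Union>b\<in>{0..c}. A b) = (\<Sum>b=0..c. card (A b))"
    using assms by (intro card_UN_disjoint) (auto simp: A_def finite_throws)
  moreover have "J n b c = card (A b)" for b
    by (simp add: J_def A_def siteswap_iff)
  ultimately show ?thesis by (simp add: J_all_def)
qed

section \<open>Siteswaps as derangements\<close>

text \<open>The extra \<open>1\<close> moves the excluded landing residue \<open>i - 1\<close> to \<open>i\<close>, so that it becomes a fixed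
  point.\<close>

definition throw_perm :: "nat \<Rightarrow> nat list \<Rightarrow> nat \<Rightarrow> nat" where
  "throw_perm n h i = (if i < n then (i + h ! i + 1) mod n else i)"

text \<open>The height is \<open>p i - i - 1\<close> modulo \<open>n\<close>; since \<open>i < n\<close>, adding \<open>n\<close> before subtracting keeps the
  difference of natural numbers from being truncated.\<close>

definition perm_throw :: "nat \<Rightarrow> (nat \<Rightarrow> nat) \<Rightarrow> nat list" where
  "perm_throw n p = map (\<lambda>i. (n - Suc i + p i) mod n) [0..<n]"

lemma throw_perm_perm_throw:
  assumes "i < n" and "p i < n"
  shows "throw_perm n (perm_throw n p) i = p i"
proof -
  have "throw_perm n (perm_throw n p) i = (i + (n - Suc i + p i) mod n + 1) mod n"
    using assms by (simp add: throw_perm_def perm_throw_def)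
  also have "\<dots> = (i + (n - Suc i + p i) + 1) mod n"
    by (metis mod_add_left_eq mod_add_right_eq)
  also have "i + (n - Suc i + p i) + 1 = n + p i"
    using assms by simp
  finally show ?thesis using assms by simp
qed

lemma perm_throw_throw_perm:
  assumes "i < n" and "h ! i < n"
  shows "perm_throw n (throw_perm n h) ! i = h ! i"
proof -
  have "perm_throw n (throw_perm n h) ! i = (n - Suc i + (i + h ! i + 1) mod n) mod n"
    using assms by (simp add: throw_perm_def perm_throw_def)
  also have "\<dots> = (n - Suc i + (i + h ! i + 1)) mod n"
    by (simp add: mod_add_right_eq)
  also have "n - Suc i + (i + h ! i + 1) = n + h ! i"
    using assms by simp
  finally show ?thesis using assms by simp
qed

lemma throw_perm_derangement:
  assumes n: "n \<ge> 2" and h: "h \<in> throws n (n - 2)"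
  shows "throw_perm n h \<in> derangements {..<n}"
proof -
  have less: "h ! i < n - 1" if "i < n" for i
    using h n that by (fastforce simp: throws_def)
  have inj: "inj_on (\<lambda>i. (i + h ! i) mod n) {..<n}"
    using h by (simp add: throws_def)
  have inj1: "inj_on (\<lambda>i. (i + h ! i + 1) mod n) {..<n}"
  proof (rule inj_onI)
    fix i j assume ij: "i \<in> {..<n}" "j \<in> {..<n}" "(i + h ! i + 1) mod n = (j + h ! j + 1) mod n"
    then have "[i + h ! i = j + h ! j] (mod n)"
      using cong_add_rcancel_nat[of "i + h ! i" 1 "j + h ! j" n] by (simp add: cong_def)
    then show "i = j"
      unfolding cong_def by (rule inj_onD[OF inj _ ij(1,2)])
  qed
  then have "bij_betw (\<lambda>i. (i + h ! i + 1) mod n) {..<n} {..<n}"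
    using inj_on_mod_self_image[OF _ inj1] n by (simp add: bij_betw_def)
  then have "bij_betw (throw_perm n h) {..<n} {..<n}"
    by (rule bij_betw_cong[THEN iffD1, rotated]) (simp add: throw_perm_def)
  then have "throw_perm n h permutes {..<n}"
    by (rule bij_imp_permutes) (simp add: throw_perm_def)
  moreover have "throw_perm n h i \<noteq> i" if i: "i < n" for i
  proof
    assume fixed: "throw_perm n h i = i"
    \<comment> \<open>A fixed point forces the height \<open>n - 1\<close>.\<close>
    have "h ! i = (n - Suc i + throw_perm n h i) mod n"
      using perm_throw_throw_perm[OF i, of h] less[OF i] i by (simp add: perm_throw_def)
    also have "\<dots> = n - 1" using fixed i by simp
    finally show False using less[OF i] by simp
  qed
  ultimately show ?thesis by (simp add: derangements_def)
qed

lemma perm_throw_in_throws: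
  assumes n: "n \<ge> 2" and p: "p \<in> derangements {..<n}"
  shows "perm_throw n p \<in> throws n (n - 2)"
proof -
  have perm: "p permutes {..<n}" and moved: "\<And>i. i < n \<Longrightarrow> p i \<noteq> i"
    using p by (auto simp: derangements_def)
  have pless: "p i < n" if "i < n" for i
    using permutes_in_image[OF perm, of i] that by simp
  have eq: "(i + perm_throw n p ! i + 1) mod n = p i" if "i < n" for i
    using throw_perm_perm_throw[of i n p] pless that by (simp add: throw_perm_def)
  have "inj_on (\<lambda>i. (i + perm_throw n p ! i) mod n) {..<n}"
  proof (rule inj_onI)
    fix i j assume ij: "i \<in> {..<n}" "j \<in> {..<n}"
      "(i + perm_throw n p ! i) mod n = (j + perm_throw n p ! j) mod n"
    then have "p i = p j"
      using eq[of i] eq[of j] by (metis lessThan_iff mod_add_left_eq)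
    then show "i = j" using permutes_inj[OF perm] by (simp add: inj_eq)
  qed
  moreover have "perm_throw n p ! i \<le> n - 2" if i: "i < n" for i
  proof -
    have "perm_throw n p ! i < n" using i by (simp add: perm_throw_def)
    moreover have "perm_throw n p ! i \<noteq> n - 1"
      using eq[OF i] moved[OF i] i by auto
    ultimately show ?thesis by linarith
  qed
  ultimately show ?thesis by (simp add: throws_def perm_throw_def)
qed

lemma throw_perm_bij:
  assumes "n \<ge> 2"
  shows "bij_betw (throw_perm n) (throws n (n - 2)) (derangements {..<n})"
proof (rule bij_betw_byWitness[where f' = "perm_throw n"])
  show "\<forall>h\<in>throws n (n - 2). perm_throw n (throw_perm n h) = h"
  proof
    fix h assume h: "h \<in> throws n (n - 2)"
    show "perm_throw n (throw_perm n h) = h"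
    proof (rule nth_equalityI)
      show "length (perm_throw n (throw_perm n h)) = length h"
        using h by (simp add: throws_def perm_throw_def)
      fix i assume "i < length (perm_throw n (throw_perm n h))"
      then have i: "i < n" by (simp add: perm_throw_def)
      then have "h ! i < n" using h assms by (fastforce simp: throws_def)
      with i show "perm_throw n (throw_perm n h) ! i = h ! i"
        by (rule perm_throw_throw_perm)
    qed
  qed
  show "\<forall>p\<in>derangements {..<n}. throw_perm n (perm_throw n p) = p"
  proof
    fix p :: "nat \<Rightarrow> nat" assume "p \<in> derangements {..<n}"
    then have p: "p permutes {..<n}" by (simp add: derangements_def)
    show "throw_perm n (perm_throw n p) = p"
    proof
      fix i show "throw_perm n (perm_throw n p) i = p i"
      proof (cases "i < n")
        case True
        then show ?thesis
          using permutes_in_image[OF p, of i] by (simp add: throw_perm_perm_throw)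
      next
        case False
        then show ?thesis
          using permutes_not_in[OF p, of i] by (simp add: throw_perm_def)
      qed
    qed
  qed
  show "throw_perm n ` throws n (n - 2) \<subseteq> derangements {..<n}"
    using throw_perm_derangement[OF assms] by blast
  show "perm_throw n ` derangements {..<n} \<subseteq> throws n (n - 2)"
    using perm_throw_in_throws[OF assms] by blast
qed

theorem mainTheorem2:
  fixes n :: nat
  assumes "n \<ge> 2"
  shows "int (J_all n (n - 2)) = (\<Sum>k=0..n. (-1) ^ k * int (n choose k) * fact (n - k))"
proof -
  have "J_all n (n - 2) = card (derangements {..<n})"
    using J_all_eq_card[of n] bij_betw_same_card[OF throw_perm_bij[OF assms]] assms by simp
  then show ?thesis
    using card_derangements[of "{..<n}"] by simp
qed

end
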